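(* Suppose that $n_1,\ldots,n_t$ are distinct positive integers, $m_1,\ldots,m_t$ are positive integers, and $H$ is the complete multipartite graph with exactly $m_i$ parts of order $n_i$ for each $1\le i\le t$ (and no other parts). Then $$\mathfrak{D}_k(H)=\prod_{i=1}^{t}\prod_{j=0}^{m_i-1}\big(k_{(n_i)}-j\,n_i!\big).$$
   Context: For a finite simple graph $G$, a $k$-coloring is any map $c:V(G)\to\{1,\dots,k\}$; it is distinguishing if the only automorphism $f$ of $G$ with $c(f(v))=c(v)$ for all $v\in V(G)$ is the identity. $\mathfrak{D}_k(G)$ is the number of distinguishing maps $c:V(G)\to\{1,\dots,k\}$ (a polynomial in $k$, called the distinguishing polynomial of $G$). $k_{(n)}=k(k-1)\cdots(k-n+1)$ is the falling factorial. *)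

theory Defs
  imports
    "Graph_Theory.Pair_Digraph"
    "HOL-Library.FuncSet"
    "HOL-Library.Disjoint_Sets"
    "HOL-Combinatorics.Permutations"
begin

text \<open>
  Finite simple graphs are the \<open>pair_graph\<close>s of the Graph Theory entry: finite, loop-free and
  symmetric relations, an undirected edge \<open>uv\<close> being represented by the arcs \<open>(u, v)\<close> and \<open>(v, u)\<close>.
\<close>

text \<open>
  With \<open>permutes\<close>, an automorphism is a function on the whole type that fixes every
  non-vertex, so the identity automorphism is exactly \<^const>\<open>id\<close>.
\<close>

definition graph_automorphism :: "'a pair_pre_digraph \<Rightarrow> ('a \<Rightarrow> 'a) \<Rightarrow> bool" where
  "graph_automorphism G f \<longleftrightarrow>
     f permutes pverts G \<and>
     (\<forall>u\<in>pverts G. \<forall>v\<in>pverts G. (f u, f v) \<in> parcs G \<longleftrightarrow> (u, v) \<in> parcs G)"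

definition distinguishing :: "'a pair_pre_digraph \<Rightarrow> ('a \<Rightarrow> nat) \<Rightarrow> bool" where
  "distinguishing G c \<longleftrightarrow>
     (\<forall>f. graph_automorphism G f \<and> (\<forall>v\<in>pverts G. c (f v) = c v) \<longrightarrow> f = id)"

text \<open>Extensional functions make each map on the vertex set count exactly once.\<close>

definition num_distinguishing :: "nat \<Rightarrow> 'a pair_pre_digraph \<Rightarrow> nat" where
  "num_distinguishing k G = card {c \<in> pverts G \<rightarrow>\<^sub>E {1..k}. distinguishing G c}"

definition complete_multipartite :: "'a pair_pre_digraph \<Rightarrow> 'a set set \<Rightarrow> bool" where
  "complete_multipartite G P \<longleftrightarrow>
     pair_graph G \<and> partition_on (pverts G) P \<and>
     parcs G = (\<Union>A\<in>P. \<Union>B\<in>P - {A}. A \<times> B)"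

definition falling_factorial :: "'a::comm_ring_1 \<Rightarrow> nat \<Rightarrow> 'a" where
  "falling_factorial x n = (\<Prod>l<n. x - of_nat l)"

end

theory Submission
  imports Defs
begin

text \<open>
  A coloring of a complete multipartite graph is distinguishing iff it is injective on every part
  and no two parts carry the same set of colors: automorphisms permute the parts, and any
  color-preserving bijection between two parts of the same order extends to an automorphism. Choosing
  the colors part by part, the part \<open>A\<close> can be colored in \<open>k\<^sub>(\<^sub>n\<^sub>)\<close> injective ways with \<open>n = |A|\<close>, from
  which the \<open>n!\<close> bijections onto each of the color sets of the \<open>j\<close> earlier parts of order \<open>n\<close>
  must be removed.
\<close>

definition separates_parts :: "'a set set \<Rightarrow> ('a \<Rightarrow> 'b) \<Rightarrow> bool" where
  "separates_parts P c \<longleftrightarrow> (\<forall>A\<in>P. inj_on c A) \<and> inj_on (image c) P"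

lemma separates_parts_cong:
  assumes "\<And>x. x \<in> \<Union>P \<Longrightarrow> c x = d x"
  shows "separates_parts P c \<longleftrightarrow> separates_parts P d"
proof -
  have "inj_on c A \<longleftrightarrow> inj_on d A" if "A \<in> P" for A
    using that assms by (intro inj_on_cong) auto
  moreover have "inj_on (image c) P \<longleftrightarrow> inj_on (image d) P"
    using assms by (intro inj_on_cong image_cong) auto
  ultimately show ?thesis
    by (simp add: separates_parts_def)
qed

section \<open>Distinguishing colorings of complete multipartite graphs\<close>

text \<open>Parts are disjoint, so the part \<open>B\<close> of \<open>v\<close> is unique, and arcs
  join exactly the pairs from different parts. Hence a part is the set of non-neighbours of any of
  its members; all later reasoning about arcs goes through this form.\<close>

lemma complete_multipartite_adj_iff:
  assumes "complete_multipartite G P" "A \<in> P" "u \<in> A" "v \<in> pverts G"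
  shows "(u, v) \<in> parcs G \<longleftrightarrow> v \<notin> A"
proof -
  have part: "partition_on (pverts G) P" and arcs: "parcs G = (\<Union>A\<in>P. \<Union>B\<in>P - {A}. A \<times> B)"
    using assms(1) by (auto simp: complete_multipartite_def)
  have same: "X = Y" if "X \<in> P" "Y \<in> P" "w \<in> X" "w \<in> Y" for X Y w
    using that partition_onD2[OF part] by (meson disjointD disjoint_iff)
  obtain B where B: "B \<in> P" "v \<in> B"
    using assms(4) partition_onD1[OF part] by auto
  have "(u, v) \<in> parcs G \<longleftrightarrow> (\<exists>X\<in>P. \<exists>Y\<in>P. Y \<noteq> X \<and> u \<in> X \<and> v \<in> Y)"
    unfolding arcs by auto
  also have "\<dots> \<longleftrightarrow> A \<noteq> B"
    using same[OF _ assms(2) _ assms(3)] same[OF _ B(1) _ B(2)] assms(2,3) B by metis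
  also have "\<dots> \<longleftrightarrow> v \<notin> A"
    using same[OF assms(2) B(1) _ B(2)] B by metis
  finally show ?thesis .
qed

text \<open>An automorphism preserves non-adjacency, so it carries the non-neighbours of
  \<open>u\<close>, which form \<open>A\<close>, onto the non-neighbours of \<open>f u\<close>,
  which form the part of \<open>f u\<close>.\<close>

lemma automorphism_image_part:
  assumes G: "complete_multipartite G P" and f: "graph_automorphism G f" and A: "A \<in> P"
  shows "f ` A \<in> P"
proof -
  have part: "partition_on (pverts G) P"
    using G by (simp add: complete_multipartite_def)
  have perm: "f permutes pverts G"
    and adj: "\<And>u v. u \<in> pverts G \<Longrightarrow> v \<in> pverts G \<Longrightarrow> (f u, f v) \<in> parcs G \<longleftrightarrow> (u, v) \<in> parcs G"
    using f by (auto simp: graph_automorphism_def)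
  have sub: "X \<subseteq> pverts G" if "X \<in> P" for X
    using that partition_onD1[OF part] by blast
  obtain u where u: "u \<in> A"
    using A partition_onD3[OF part] by fastforce
  have "f u \<in> pverts G"
    using u sub[OF A] permutes_in_image[OF perm] by blast
  then obtain B where B: "B \<in> P" "f u \<in> B"
    using partition_onD1[OF part] by auto
  have iff: "f v \<in> B \<longleftrightarrow> v \<in> A" if v: "v \<in> pverts G" for v
    using complete_multipartite_adj_iff[OF G A u v]
      complete_multipartite_adj_iff[OF G B, of "f v"] adj[of u v] u v sub[OF A]
      permutes_in_image[OF perm] by blast
  have "f ` A = B"
  proof
    show "f ` A \<subseteq> B"
      using iff sub[OF A] by blast
    \<comment> \<open>Since \<open>f\<close> is onto the vertex set, each \<open>w\<close> in
      \<open>B\<close> has a preimage, and \<open>iff\<close> places that preimage in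
      \<open>A\<close>.\<close>
    show "B \<subseteq> f ` A"
    proof
      fix w assume w: "w \<in> B"
      then obtain v where "v \<in> pverts G" "w = f v"
        using sub[OF B(1)] permutes_image[OF perm] by blast
      then show "w \<in> f ` A"
        using iff w by blast
    qed
  qed
  then show ?thesis
    using B by simp
qed

text \<open>Adjacency depends only on whether two parts differ, and injectivity of \<pi> keeps
  different parts different. The action on parts is an explicit map so that a use has to supply only
  membership \<open>f u \<in> \<pi> A\<close>: below, \<pi> is the identity or a swap of two
  parts.\<close>

lemma graph_automorphism_if_part_map:
  assumes G: "complete_multipartite G P" and perm: "f permutes pverts G"
    and \<pi>: "inj_on \<pi> P" "\<And>A. A \<in> P \<Longrightarrow> \<pi> A \<in> P" "\<And>A u. A \<in> P \<Longrightarrow> u \<in> A \<Longrightarrow> f u \<in> \<pi> A"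
  shows "graph_automorphism G f"
  unfolding graph_automorphism_def
proof (intro conjI perm ballI)
  fix u v assume uv: "u \<in> pverts G" "v \<in> pverts G"
  have part: "partition_on (pverts G) P"
    using G by (simp add: complete_multipartite_def)
  obtain A B where AB: "A \<in> P" "u \<in> A" "B \<in> P" "v \<in> B"
    using uv partition_onD1[OF part] by auto
  have same: "X = Y" if "X \<in> P" "Y \<in> P" "w \<in> X" "w \<in> Y" for X Y w
    using that partition_onD2[OF part] by (meson disjointD disjoint_iff)
  have "(f u, f v) \<in> parcs G \<longleftrightarrow> f v \<notin> \<pi> A"
    using complete_multipartite_adj_iff[OF G \<pi>(2)[OF AB(1)] \<pi>(3)[OF AB(1,2)]] uv
      permutes_in_image[OF perm] by blast
  also have "\<dots> \<longleftrightarrow> \<pi> A \<noteq> \<pi> B"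
    using same \<pi>(2,3) AB by blast
  also have "\<dots> \<longleftrightarrow> A \<noteq> B"
    using \<pi>(1) AB by (auto dest: inj_onD)
  also have "\<dots> \<longleftrightarrow> v \<notin> A"
    using same AB by blast
  also have "\<dots> \<longleftrightarrow> (u, v) \<in> parcs G"
    using complete_multipartite_adj_iff[OF G AB(1,2) uv(2)] by blast
  finally show "(f u, f v) \<in> parcs G \<longleftrightarrow> (u, v) \<in> parcs G" .
qed

text \<open>Each failure of separation yields a nontrivial color-preserving automorphism: two
  vertices of one part with the same color can be swapped, and two parts with the same color set can
  be exchanged color by color.\<close>

lemma distinguishing_imp_separates_parts:
  assumes G: "complete_multipartite G P" and c: "distinguishing G c"
  shows "separates_parts P c"
proof -
  have part: "partition_on (pverts G) P" and "pair_graph G"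
    using G by (simp_all add: complete_multipartite_def)
  then have fin: "finite (pverts G)"
    by (simp add: pair_graph_def pair_digraph_def pair_fin_digraph_def pair_fin_digraph_axioms_def)
  have sub: "X \<subseteq> pverts G" if "X \<in> P" for X
    using that partition_onD1[OF part] by blast
  have same: "X = Y" if "X \<in> P" "Y \<in> P" "w \<in> X" "w \<in> Y" for X Y w
    using that partition_onD2[OF part] by (meson disjointD disjoint_iff)
  have id: "f = id" if "graph_automorphism G f" "\<And>v. v \<in> pverts G \<Longrightarrow> c (f v) = c v" for f
    using c that by (auto simp: distinguishing_def)
  have inj: "inj_on c A" if A: "A \<in> P" for A
  proof (rule inj_onI)
    fix u v assume uv: "u \<in> A" "v \<in> A" "c u = c v"
    \<comment> \<open>Both vertices lie in \<open>A\<close>, so the swap maps every part into itself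
      and \<pi> can be the identity.\<close>
    let ?f = "Transposition.transpose u v"
    have "?f permutes pverts G"
      using uv sub[OF A] by (intro permutes_swap_id) auto
    moreover have "?f w \<in> B" if "B \<in> P" "w \<in> B" for B w
      using that uv same[OF A that(1)] by (auto simp: Transposition.transpose_def)
    ultimately have "graph_automorphism G ?f"
      using G by (intro graph_automorphism_if_part_map[where \<pi> = "\<lambda>B. B" and P = P]) auto
    moreover have "c (?f w) = c w" for w
      using uv(3) by (auto simp: Transposition.transpose_def)
    ultimately have "?f = id"
      by (intro id) auto
    then show "u = v"
      by (metis id_apply transpose_apply_first)
  qed
  have "A = B" if AB: "A \<in> P" "B \<in> P" and eq: "c ` A = c ` B" for A B
  proof (rule ccontr)
    assume "A \<noteq> B"
    then have disj: "A \<inter> B = {}"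
      using same AB by blast
    \<comment> \<open>\<open>g X y\<close> picks a vertex of \<open>X\<close> with color
      \<open>y\<close>. As \<open>A\<close> and \<open>B\<close> have the same colors,
      \<open>g B\<close> is defined on the colors of \<open>A\<close> and \<open>g A\<close> on
      those of \<open>B\<close>, which lets \<open>f\<close> exchange the two parts by matching
      colors.\<close>
    define g where "g = (\<lambda>X. inv_into X c)"
    have g: "g X y \<in> X" "c (g X y) = y" if "y \<in> c ` X" for X y
      unfolding g_def using that by (rule inv_into_into, rule f_inv_into_f)
    have gB: "g B (c u) \<in> B" "c (g B (c u)) = c u" if "u \<in> A" for u
      using that eq by (intro g; blast)+
    have gA: "g A (c u) \<in> A" "c (g A (c u)) = c u" if "u \<in> B" for u
      using that eq by (intro g; blast)+
    define f where "f = (\<lambda>u. if u \<in> A then g B (c u) else if u \<in> B then g A (c u) else u)"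
    have fA: "f u \<in> B" "c (f u) = c u" if "u \<in> A" for u
      using that gB by (auto simp: f_def)
    have fB: "f u \<in> A" "c (f u) = c u" if "u \<in> B" for u
      using that gA disj by (auto simp: f_def)
    have f_other: "f u = u" if "u \<notin> A" "u \<notin> B" for u
      using that by (simp add: f_def)
    have c_f: "c (f u) = c u" for u
      using fA fB f_other by metis
    \<comment> \<open>For \<open>u\<close> in \<open>A\<close> or \<open>B\<close>, applying
      \<open>f\<close> twice returns to the same part with the same color, and \<open>c\<close> is
      injective there. Being an involution makes \<open>f\<close> a permutation.\<close>
    have "f (f u) = u" for u
    proof -
      consider "u \<in> A" | "u \<in> B" | "u \<notin> A" "u \<notin> B" by blast
      then show ?thesis
      proof cases
        case 1
        then have "f (f u) \<in> A"
          using fA fB by blast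
        then show ?thesis
          using 1 inj_onD[OF inj[OF AB(1)]] c_f by metis
      next
        case 2
        then have "f (f u) \<in> B"
          using fA fB by blast
        then show ?thesis
          using 2 inj_onD[OF inj[OF AB(2)]] c_f by metis
      qed (simp add: f_other)
    qed
    then have "inj f"
      by (metis injI)
    then have "f permutes pverts G"
    proof (intro inj_imp_permutes fin)
      show "inj_on f (pverts G)"
        using \<open>inj f\<close> by (rule inj_on_subset) simp
      show "f x \<in> pverts G" if "x \<in> pverts G" for x
        using that fA fB f_other sub AB by (metis subsetD)
      show "f x = x" if "x \<notin> pverts G" for x
        using that sub AB f_other by blast
    qed
    \<comment> \<open>Here \<pi> is the transposition of \<open>A\<close> and \<open>B\<close>
      inside the set of parts.\<close>
    moreover have "f u \<in> Transposition.transpose A B X" if X: "X \<in> P" "u \<in> X" for X u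
    proof -
      have "u \<in> A \<longleftrightarrow> X = A" "u \<in> B \<longleftrightarrow> X = B"
        using X AB same by blast+
      then show ?thesis
        using fA fB f_other X by (auto simp: Transposition.transpose_def)
    qed
    moreover have "inj_on (Transposition.transpose A B) P"
      by (rule inj_on_inverseI[where g = "Transposition.transpose A B"]) simp
    moreover have "Transposition.transpose A B X \<in> P" if "X \<in> P" for X
      using that AB by (simp add: Transposition.transpose_def)
    ultimately have "graph_automorphism G f"
      using graph_automorphism_if_part_map[OF G] by blast
    then have "f = id"
      using c_f by (intro id) auto
    \<comment> \<open>Parts are nonempty, so some vertex of \<open>A\<close> is moved into the
      disjoint part \<open>B\<close>, which the identity cannot do.\<close>
    moreover obtain u where "u \<in> A"
      using AB(1) partition_onD3[OF part] by fastforce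
    ultimately show False
      using fA disj by fastforce
  qed
  then show ?thesis
    using inj by (simp add: separates_parts_def inj_on_def)
qed

text \<open>A color-preserving automorphism sends \<open>A\<close> to a part with the same color
  set, hence to \<open>A\<close> itself. Then \<open>u\<close> and \<open>f u\<close> are equally
  colored vertices of one part, so they coincide.\<close>

lemma separates_parts_imp_distinguishing:
  assumes G: "complete_multipartite G P" and c: "separates_parts P c"
  shows "distinguishing G c"
  unfolding distinguishing_def
proof (intro allI impI, elim conjE)
  fix f assume f: "graph_automorphism G f" and cf: "\<forall>v\<in>pverts G. c (f v) = c v"
  have part: "partition_on (pverts G) P"
    using G by (simp add: complete_multipartite_def)
  have perm: "f permutes pverts G"
    using f by (simp add: graph_automorphism_def)
  show "f = id"
  proof
    fix u
    show "f u = id u"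
    proof (cases "u \<in> pverts G")
      case False
      then show ?thesis
        using permutes_not_in[OF perm] by simp
    next
      case True
      then obtain A where A: "A \<in> P" "u \<in> A"
        using partition_onD1[OF part] by auto
      have "c ` (f ` A) = c ` A"
        unfolding image_image using cf A(1) partition_onD1[OF part] by (intro image_cong) auto
      moreover have "inj_on (image c) P"
        using c by (simp add: separates_parts_def)
      ultimately have "f ` A = A"
        using automorphism_image_part[OF G f A(1)] A(1) by (simp add: inj_on_eq_iff)
      then have "f u \<in> A"
        using A by blast
      moreover have "c (f u) = c u"
        using cf True by blast
      ultimately show ?thesis
        using c A by (auto simp: separates_parts_def dest: inj_onD)
    qed
  qed
qed

section \<open>Counting the colorings that separate the parts\<close>

lemma card_inj_funcset_falling_factorial:
  assumes "finite A" "finite C"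
  shows "int (card {h \<in> A \<rightarrow>\<^sub>E C. inj_on h A}) = falling_factorial (int (card C)) (card A)"
proof -
  have "int (\<Prod>l=0..<card A. card C - l) = (\<Prod>l<card A. int (card C) - int l)"
  proof (cases "card A \<le> card C")
    case True
    then show ?thesis
      by (auto simp: atLeast0LessThan intro!: prod.cong)
  next
    \<comment> \<open>With fewer colors than vertices, both products contain the zero factor at
      \<open>l = card C\<close>; the truncated subtraction for larger \<open>l\<close> does no
      harm.\<close>
    case False
    then have "(\<Prod>l=0..<card A. card C - l) = 0" "(\<Prod>l<card A. int (card C) - int l) = 0"
      by (auto intro!: bexI[of _ "card C"])
    then show ?thesis
      by (simp only: of_nat_0)
  qed
  then show ?thesis
    using assms by (simp add: card_inj_on_subset_funcset falling_factorial_def)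
qed

lemma card_inj_funcset_same_card:
  assumes "finite A" "finite S" "card S = card A"
  shows "card {h \<in> A \<rightarrow>\<^sub>E S. inj_on h A} = fact (card A)"
  using assms by (simp add: card_inj_on_subset_funcset fact_prod_rev)

text \<open>The image of an injection on \<open>A\<close> has \<open>card A\<close> elements, so
  only forbidden sets of that size exclude anything. Each of them excludes its
  \<open>fact (card A)\<close> bijections, and different sets exclude different maps.\<close>

lemma card_inj_funcset_avoiding:
  assumes A: "finite A" and C: "finite C" and \<S>: "\<And>S. S \<in> \<S> \<Longrightarrow> S \<subseteq> C"
  shows "int (card {h \<in> A \<rightarrow>\<^sub>E C. inj_on h A \<and> h ` A \<notin> \<S>}) =
    falling_factorial (int (card C)) (card A) - int (card {S \<in> \<S>. card S = card A}) * fact (card A)"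
proof -
  let ?I = "{h \<in> A \<rightarrow>\<^sub>E C. inj_on h A}"
  let ?T = "{S \<in> \<S>. card S = card A}"
  let ?B = "\<lambda>S. {h \<in> A \<rightarrow>\<^sub>E S. inj_on h A}"
  have "\<S> \<subseteq> Pow C"
    using \<S> by blast
  then have finT: "finite ?T"
    using C finite_subset by fastforce
  have finS: "finite S" if "S \<in> ?T" for S
    using that \<S> C by (auto intro: finite_subset)
  have finI: "finite ?I"
    by (rule finite_subset[of _ "A \<rightarrow>\<^sub>E C"]) (auto intro: finite_PiE A C)
  \<comment> \<open>An injection into a finite set of the same size is onto. Therefore
    \<open>h\<close> determines \<open>S\<close>, which makes the union below disjoint.\<close>
  have img: "h ` A = S" if "S \<in> ?T" "h \<in> ?B S" for h S
    using that finS[OF that(1)] by (intro card_subset_eq) (auto simp: card_image)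
  have bad: "{h \<in> ?I. h ` A \<in> \<S>} = (\<Union>S\<in>?T. ?B S)"
  proof (intro equalityI subsetI)
    fix h assume "h \<in> {h \<in> ?I. h ` A \<in> \<S>}"
    then have "h ` A \<in> ?T" "h \<in> ?B (h ` A)"
      by (auto simp: card_image PiE_iff)
    then show "h \<in> (\<Union>S\<in>?T. ?B S)"
      by blast
  next
    fix h assume "h \<in> (\<Union>S\<in>?T. ?B S)"
    then obtain S where S: "S \<in> ?T" "h \<in> ?B S"
      by blast
    then show "h \<in> {h \<in> ?I. h ` A \<in> \<S>}"
      using img[OF S] \<S> by (auto simp: PiE_iff)
  qed
  have "card (\<Union>S\<in>?T. ?B S) = (\<Sum>S\<in>?T. card (?B S))"
  proof (intro card_UN_disjoint finT ballI impI)
    show "finite (?B S)" if "S \<in> ?T" for S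
      by (rule finite_subset[of _ "A \<rightarrow>\<^sub>E S"]) (auto intro: finite_PiE A finS[OF that])
    show "?B S \<inter> ?B S' = {}" if "S \<in> ?T" "S' \<in> ?T" "S \<noteq> S'" for S S'
      using that img by blast
  qed
  also have "\<dots> = (\<Sum>S\<in>?T. fact (card A))"
    using finS A by (intro sum.cong card_inj_funcset_same_card) auto
  finally have card_bad: "card {h \<in> ?I. h ` A \<in> \<S>} = card ?T * fact (card A)"
    unfolding bad by simp
  have "{h \<in> A \<rightarrow>\<^sub>E C. inj_on h A \<and> h ` A \<notin> \<S>} = ?I - {h \<in> ?I. h ` A \<in> \<S>}"
    by blast
  moreover have "card (?I - {h \<in> ?I. h ` A \<in> \<S>}) = card ?I - card {h \<in> ?I. h ` A \<in> \<S>}"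
    by (rule card_Diff_subset) (auto intro: finite_subset[OF _ finI])
  moreover have "card {h \<in> ?I. h ` A \<in> \<S>} \<le> card ?I"
    by (rule card_mono[OF finI]) blast
  ultimately have "int (card {h \<in> A \<rightarrow>\<^sub>E C. inj_on h A \<and> h ` A \<notin> \<S>}) =
      int (card ?I) - int (card {h \<in> ?I. h ` A \<in> \<S>})"
    by (simp only: of_nat_diff)
  then show ?thesis
    by (simp only: card_bad card_inj_funcset_falling_factorial[OF A C] of_nat_mult of_nat_fact)
qed

text \<open>No graph occurs here, so the count can proceed by induction on the set of parts.\<close>

definition part_colorings :: "'a set set \<Rightarrow> 'b set \<Rightarrow> ('a \<Rightarrow> 'b) set" where
  "part_colorings P C = {c \<in> \<Union>P \<rightarrow>\<^sub>E C. separates_parts P c}"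

lemma separates_parts_insert:
  assumes "A \<notin> P"
  shows "separates_parts (insert A P) c \<longleftrightarrow>
    separates_parts P c \<and> inj_on c A \<and> c ` A \<notin> image c ` P"
  using assms by (auto simp: separates_parts_def)

text \<open>A coloring of the old parts extends to \<open>A\<close> in a number of ways that does
  not depend on the coloring: the old color sets are pairwise distinct and have the sizes of their
  parts, so exactly as many are forbidden as there are old parts of size
  \<open>card A\<close>.\<close>

lemma card_part_colorings_insert:
  assumes fin: "finite P" "\<And>B. B \<in> insert A P \<Longrightarrow> finite B" and C: "finite C"
    and A: "A \<notin> P" and disj: "A \<inter> \<Union>P = {}"
  shows "int (card (part_colorings (insert A P) C)) =
    int (card (part_colorings P C)) *
      (falling_factorial (int (card C)) (card A) -
        int (card {B \<in> P. card B = card A}) * fact (card A))"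
    (is "_ = _ * ?r")
proof -
  \<comment> \<open>\<open>E g\<close> collects the admissible colorings of the new part once the
    old parts are colored by \<open>g\<close>.\<close>
  define E where "E = (\<lambda>g. {h \<in> A \<rightarrow>\<^sub>E C. inj_on h A \<and> h ` A \<notin> image g ` P})"
  have sep: "separates_parts (insert A P) c \<longleftrightarrow>
      separates_parts P g \<and> inj_on h A \<and> h ` A \<notin> image g ` P"
    if "\<And>x. x \<in> \<Union>P \<Longrightarrow> c x = g x" "\<And>x. x \<in> A \<Longrightarrow> c x = h x" for c g :: "'a \<Rightarrow> 'b" and h
  proof -
    have "separates_parts P c = separates_parts P g"
      using that by (intro separates_parts_cong) auto
    moreover have "inj_on c A = inj_on h A"
      using that by (intro inj_on_cong) auto
    moreover have "c ` A = h ` A"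
      using that by (intro image_cong) auto
    moreover have "image c ` P = image g ` P"
      using that by (intro image_cong) auto
    ultimately show ?thesis
      by (simp add: separates_parts_insert[OF A])
  qed
  have "bij_betw (\<lambda>c. (restrict c (\<Union>P), restrict c A))
      (part_colorings (insert A P) C) (SIGMA g:part_colorings P C. E g)"
  \<comment> \<open>Outside all parts the glued map takes the value of \<open>g\<close>, which is
    \<open>undefined\<close> there, so it is again extensional.\<close>
  proof (rule bij_betw_byWitness[where f' = "\<lambda>(g, h) x. if x \<in> A then h x else g x"])
    show "\<forall>c\<in>part_colorings (insert A P) C.
        (case (restrict c (\<Union>P), restrict c A) of (g, h) \<Rightarrow> \<lambda>x. if x \<in> A then h x else g x) = c"
      by (auto simp: part_colorings_def fun_eq_iff PiE_iff extensional_def)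
    show "\<forall>p\<in>SIGMA g:part_colorings P C. E g.
        (restrict (case p of (g, h) \<Rightarrow> \<lambda>x. if x \<in> A then h x else g x) (\<Union>P),
         restrict (case p of (g, h) \<Rightarrow> \<lambda>x. if x \<in> A then h x else g x) A) = p"
      using disj by (fastforce simp: part_colorings_def E_def fun_eq_iff PiE_iff extensional_def)
    show "(\<lambda>c. (restrict c (\<Union>P), restrict c A)) ` part_colorings (insert A P) C
        \<subseteq> (SIGMA g:part_colorings P C. E g)"
    proof (rule image_subsetI)
      fix c assume c: "c \<in> part_colorings (insert A P) C"
      then have "separates_parts P (restrict c (\<Union>P)) \<and> inj_on (restrict c A) A \<and>
          restrict c A ` A \<notin> image (restrict c (\<Union>P)) ` P"
        by (subst sep[of c, symmetric]) (auto simp: part_colorings_def)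
      then show "(restrict c (\<Union>P), restrict c A) \<in> (SIGMA g:part_colorings P C. E g)"
        using c by (auto simp: part_colorings_def E_def PiE_iff)
    qed
    show "(\<lambda>(g, h) x. if x \<in> A then h x else g x) ` (SIGMA g:part_colorings P C. E g)
        \<subseteq> part_colorings (insert A P) C"
    proof (rule image_subsetI, clarify)
      fix g h assume gh: "g \<in> part_colorings P C" "h \<in> E g"
      let ?c = "\<lambda>x. if x \<in> A then h x else g x"
      have "separates_parts (insert A P) ?c"
        using gh disj by (subst sep[of ?c g h]) (auto simp: part_colorings_def E_def)
      then show "?c \<in> part_colorings (insert A P) C"
        using gh by (auto simp: part_colorings_def E_def PiE_iff extensional_def)
    qed
  qed
  then have eq: "card (part_colorings (insert A P) C) = card (SIGMA g:part_colorings P C. E g)"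
    by (rule bij_betw_same_card)
  have finP: "finite (part_colorings P C)"
    unfolding part_colorings_def
    by (rule finite_subset[of _ "\<Union>P \<rightarrow>\<^sub>E C"]) (auto intro!: finite_PiE simp: fin C)
  have finE: "finite (E g)" for g
    unfolding E_def by (rule finite_subset[of _ "A \<rightarrow>\<^sub>E C"]) (auto intro!: finite_PiE simp: fin C)
  have card_E: "int (card (E g)) = ?r" if g: "g \<in> part_colorings P C" for g
  proof -
    have card_img: "card (g ` B) = card B" if "B \<in> P" for B
      using g that by (simp add: part_colorings_def separates_parts_def card_image)
    have "{S \<in> image g ` P. card S = card A} = image g ` {B \<in> P. card B = card A}"
      using card_img by auto
    \<comment> \<open>This is where the second half of \<open>separates_parts\<close> enters the
      count: distinct old parts forbid distinct color sets.\<close>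
    moreover have "inj_on (image g) {B \<in> P. card B = card A}"
      using g by (auto simp: part_colorings_def separates_parts_def intro: inj_on_subset)
    ultimately have "card {S \<in> image g ` P. card S = card A} = card {B \<in> P. card B = card A}"
      by (simp add: card_image)
    moreover have "S \<subseteq> C" if "S \<in> image g ` P" for S
      using g that by (auto simp: part_colorings_def PiE_iff)
    ultimately show ?thesis
      unfolding E_def using fin C by (subst card_inj_funcset_avoiding) auto
  qed
  have "int (card (SIGMA g:part_colorings P C. E g)) = (\<Sum>g\<in>part_colorings P C. int (card (E g)))"
    using finP finE by simp
  also have "\<dots> = int (card (part_colorings P C)) * ?r"
    using card_E by simp
  finally show ?thesis
    unfolding eq .
qed

text \<open>Parts are inserted one at a time. The index set \<open>N\<close> may contain more sizes
  than occur, so it stays fixed during the induction; a size not yet present contributes an empty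
  product.\<close>

lemma card_part_colorings:
  assumes "finite P" "\<And>A. A \<in> P \<Longrightarrow> finite A" "disjoint P" "finite C"
    and "finite N" "card ` P \<subseteq> N"
  shows "int (card (part_colorings P C)) =
    (\<Prod>s\<in>N. \<Prod>j=0..<card {A \<in> P. card A = s}. falling_factorial (int (card C)) s - int j * fact s)"
  using assms(1-3,6)
proof (induction P rule: finite_induct)
  case empty
  show ?case
    by (simp add: part_colorings_def separates_parts_def)
next
  case (insert A P)
  let ?F = "\<lambda>s j. falling_factorial (int (card C)) s - int j * fact s"
  define num :: "'a set set \<Rightarrow> nat \<Rightarrow> nat" where "num Q s = card {A \<in> Q. card A = s}" for Q s
  have "disjoint P"
    using insert.prems(2) by (rule pairwise_subset) blast
  then have IH: "int (card (part_colorings P C)) = (\<Prod>s\<in>N. \<Prod>j=0..<num P s. ?F s j)"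
    unfolding num_def using insert.prems by (intro insert.IH) auto
  have disj: "A \<inter> \<Union>P = {}"
    using insert.prems(2) insert.hyps(2) by (auto simp: pairwise_insert disjnt_iff)
  have A: "card A \<in> N"
    using insert.prems by simp
  have num_eq: "num (insert A P) (card A) = Suc (num P (card A))"
  proof -
    have "{B \<in> insert A P. card B = card A} = insert A {B \<in> P. card B = card A}"
      by auto
    then show ?thesis
      using insert.hyps by (simp add: num_def)
  qed
  have num_neq: "num (insert A P) s = num P s" if "s \<noteq> card A" for s
    unfolding num_def using that by (intro arg_cong[where f = card]) auto
  \<comment> \<open>With \<open>num P (card A)\<close> earlier parts of this size, the indices
    \<open>j\<close> used so far stop just below that number. The new factor is thus the next one in
    the product for \<open>s = card A\<close>, which is split off to absorb it.\<close>
  have "int (card (part_colorings (insert A P) C)) =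
      (\<Prod>s\<in>N. \<Prod>j=0..<num P s. ?F s j) * ?F (card A) (num P (card A))"
    using insert disj assms(4) IH by (subst card_part_colorings_insert) (auto simp: num_def)
  also have "\<dots> = (\<Prod>s\<in>N - {card A}. \<Prod>j=0..<num P s. ?F s j) *
      (\<Prod>j=0..<Suc (num P (card A)). ?F (card A) j)"
    by (subst prod.remove[OF assms(5) A]) (simp add: mult_ac)
  also have "\<dots> = (\<Prod>s\<in>N - {card A}. \<Prod>j=0..<num (insert A P) s. ?F s j) *
      (\<Prod>j=0..<num (insert A P) (card A). ?F (card A) j)"
    unfolding num_eq by (intro arg_cong2[where f = "(*)"] prod.cong) (auto simp: num_neq)
  also have "\<dots> = (\<Prod>s\<in>N. \<Prod>j=0..<num (insert A P) s. ?F s j)"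
    by (subst prod.remove[OF assms(5) A]) (simp add: mult_ac)
  finally show ?case
    unfolding num_def .
qed

section \<open>The product formula for prescribed part sizes and multiplicities\<close>

theorem theorem3p5:
  fixes t :: nat and n m :: "nat \<Rightarrow> nat" and k :: nat
    and H :: "'a pair_pre_digraph" and P :: "'a set set"
  assumes "inj_on n {1..t}"
    and "\<And>i. i \<in> {1..t} \<Longrightarrow> n i > 0"
    and "\<And>i. i \<in> {1..t} \<Longrightarrow> m i > 0"
    and "complete_multipartite H P"
    and "\<And>i. i \<in> {1..t} \<Longrightarrow> card {A \<in> P. card A = n i} = m i"
    and "\<And>A. A \<in> P \<Longrightarrow> card A \<in> n ` {1..t}"
  shows "int (num_distinguishing k H) =
    (\<Prod>i=1..t. \<Prod>j=0..<m i. falling_factorial (int k) (n i) - int j * fact (n i))"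
proof -
  have part: "partition_on (pverts H) P" and "pair_graph H"
    using assms(4) by (simp_all add: complete_multipartite_def)
  then have fin: "finite (pverts H)"
    by (simp add: pair_graph_def pair_digraph_def pair_fin_digraph_def pair_fin_digraph_axioms_def)
  have V: "pverts H = \<Union>P"
    using part by (rule partition_onD1)
  have "finite P" "\<And>A. A \<in> P \<Longrightarrow> finite A"
    using fin unfolding V by (auto intro: finite_UnionD finite_subset)
  have "num_distinguishing k H = card (part_colorings P {1..k})"
    unfolding num_distinguishing_def part_colorings_def V[symmetric]
    using distinguishing_imp_separates_parts[OF assms(4)]
      separates_parts_imp_distinguishing[OF assms(4)]
    by metis
  also have "int \<dots> = (\<Prod>s\<in>n ` {1..t}. \<Prod>j=0..<card {A \<in> P. card A = s}.
      falling_factorial (int (card {1..k})) s - int j * fact s)"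
    using \<open>finite P\<close> \<open>\<And>A. A \<in> P \<Longrightarrow> finite A\<close> partition_onD2[OF part] assms(6)
    by (intro card_part_colorings) auto
  also have "\<dots> = (\<Prod>i=1..t. \<Prod>j=0..<m i. falling_factorial (int k) (n i) - int j * fact (n i))"
    using assms(5) by (simp add: prod.reindex[OF assms(1)] del: One_nat_def)
  finally show ?thesis .
qed

end
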